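(* Let $W\subset S^1$ with $|W|=5$. Then $P(W)$ holds unless $W\cong\{0,\tfrac15,\tfrac25,\tfrac35,\tfrac45\}$ (the vertex set of a regular pentagon).
   Context: Identify $S^1$ with $\mathbb{R}/\mathbb{Z}$. The group $O(2)$ acts on $S^1$ by translations $x\mapsto x+a$ and reflections $x\mapsto -x+2a$. A coloring $c:S^1\to\{R,B\}$ is distinguishing if no non-identity $\gamma\in O(2)$ satisfies $c\circ\gamma=c$. For $W\subset S^1$ with trivial pointwise stabilizer in $O(2)$, $P(W)$ holds if every precoloring $c:S^1\setminus W\to\{R,B\}$ extends to a distinguishing coloring of $S^1$. Write $W\cong W'$ if $W'=\gamma(W)$ for some $\gamma\in O(2)$. *)

theory Defs
  imports Complex_Main
begin

text \<open>The circle S^1 = R/Z, represented by the canonical representatives in [0,1).\<close>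

typedef circle = "{x::real. 0 \<le> x \<and> x < 1}"
  by (rule exI[of _ 0]) simp

definition pt :: "real \<Rightarrow> circle" where
  "pt x = Abs_circle (frac x)"

definition rot :: "real \<Rightarrow> circle \<Rightarrow> circle" where
  "rot a p = pt (Rep_circle p + a)"

definition refl :: "real \<Rightarrow> circle \<Rightarrow> circle" where
  "refl a p = pt (- Rep_circle p + 2 * a)"

definition O2 :: "(circle \<Rightarrow> circle) set" where
  "O2 = range rot \<union> range refl"

text \<open>Colorings c : S^1 -> {R,B}, with R = True, B = False.\<close>
definition distinguishing :: "(circle \<Rightarrow> bool) \<Rightarrow> bool" where
  "distinguishing c \<longleftrightarrow> (\<forall>\<gamma>\<in>O2. \<gamma> \<noteq> id \<longrightarrow> c \<circ> \<gamma> \<noteq> c)"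

definition trivial_pointwise_stabilizer :: "circle set \<Rightarrow> bool" where
  "trivial_pointwise_stabilizer W \<longleftrightarrow> (\<forall>\<gamma>\<in>O2. (\<forall>w\<in>W. \<gamma> w = w) \<longrightarrow> \<gamma> = id)"

definition propP :: "circle set \<Rightarrow> bool" where
  "propP W \<longleftrightarrow> trivial_pointwise_stabilizer W \<and>
     (\<forall>c :: circle \<Rightarrow> bool. \<exists>c'. (\<forall>x. x \<notin> W \<longrightarrow> c' x = c x) \<and> distinguishing c')"

definition O2_congruent :: "circle set \<Rightarrow> circle set \<Rightarrow> bool" where
  "O2_congruent W W' \<longleftrightarrow> (\<exists>\<gamma>\<in>O2. W' = \<gamma> ` W)"

definition pentagon :: "circle set" where
  "pentagon = pt ` {0, 1/5, 2/5, 3/5, 4/5}"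

end

theory Submission
  imports Defs "HOL-Library.Groups_Big_Fun" "HOL-Library.Infinite_Set"
begin

text \<open>
  A reflection \<open>x \<mapsto> b - x\<close> exchanges the two orientations of a triangle, so a finite set with a
  reflection symmetry contains as many translates of a scalene triangle \<open>{p, q, r}\<close> as of its mirror
  image. Summing this excess with signs over the eight ways to color \<open>p\<close>, \<open>q\<close>, \<open>r\<close> isolates the
  translates lying exactly on \<open>{p, q, r}\<close>, of which there is one in the first orientation and none
  in the second. Hence not all eight colorings can have reflections.

  For infinite color classes only differences of the excess between almost equal colorings make
  sense, and for colorings with reflections these are half the values of a homomorphism (the drift)
  on the group of translations that almost preserve the coloring. If the drift does not vanish at
  some \<open>t\<close>, then the coloring jumps between the two ends of finitely many \<open>t\<close>-orbits. Weighting the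
  coloring by these jumps gives a second odd density, whose drift is proportional to the first one.
  As the second density is linear in the coloring, its signed sum over the eight colorings is zero.

  Translation symmetries need no separate treatment: if a coloring and its recoloring at one
  point both have symmetries, then the coloring has a reflection symmetry. Finally, five points of
  the circle without a scalene triple form a regular pentagon.
\<close>

subsection \<open>Almost periods and drift\<close>

lemma Sum_any_add:
  assumes "MOST x. F x = 0" "MOST x. G x = 0"
  shows "Sum_any (\<lambda>x. F x + G x) = Sum_any F + Sum_any G"
  using assms by (intro Sum_any.distrib) (simp_all add: eventually_cofinite)

lemma Sum_any_minus: "Sum_any (\<lambda>x. - F x) = - Sum_any F"
  for F :: "'a \<Rightarrow> 'b::ab_group_add"
  by (simp add: Sum_any.expand_set sum_negf)

lemma Sum_any_diff:
  fixes F G :: "'a \<Rightarrow> 'b::ab_group_add"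
  assumes "MOST x. F x = 0" "MOST x. G x = 0"
  shows "Sum_any (\<lambda>x. F x - G x) = Sum_any F - Sum_any G"
  using Sum_any_add[of F "\<lambda>x. - G x"] assms by (simp add: Sum_any_minus)

lemma Sum_any_shift: "Sum_any (\<lambda>x. F (x + a)) = Sum_any F"
  for a :: "'a::group_add"
  by (rule Sum_any.reindex_cong[symmetric, of "\<lambda>x. x + a"])
     (auto simp: fun_eq_iff intro!: bij_betw_byWitness[where f' = "\<lambda>x. x - a"])

lemma Sum_any_reflect: "Sum_any (\<lambda>x. F (b - x)) = Sum_any F"
  for b :: "'a::ab_group_add"
  by (rule Sum_any.reindex_cong[symmetric, of "\<lambda>x. b - x"])
     (auto simp: fun_eq_iff intro!: bij_betw_byWitness[where f' = "\<lambda>x. b - x"])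

lemma MOST_shift: "MOST x. P x \<Longrightarrow> MOST x. P (x + a)" for a :: "'a::group_add"
  by (rule MOST_inj) (auto simp: inj_def)

lemma MOST_reflect: "MOST x. P x \<Longrightarrow> MOST x. P (b - x)" for b :: "'a::ab_group_add"
  by (rule MOST_inj) (auto simp: inj_def)

definition almost_period :: "('a::ab_group_add \<Rightarrow> 'b) \<Rightarrow> 'a \<Rightarrow> bool" where
  "almost_period F a \<longleftrightarrow> (MOST x. F (x + a) = F x)"

definition drift :: "('a::ab_group_add \<Rightarrow> 'b::ab_group_add) \<Rightarrow> 'a \<Rightarrow> 'b" where
  "drift F a = Sum_any (\<lambda>x. F (x + a) - F x)"

lemma almost_period_iff_finite: "almost_period F a \<longleftrightarrow> finite {x. F (x + a) \<noteq> F x}"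
  by (simp add: almost_period_def eventually_cofinite)

lemma almost_period_MOST_diff: "almost_period F a \<Longrightarrow> MOST x. F (x + a) - F x = 0"
  for F :: "'a::ab_group_add \<Rightarrow> 'b::group_add"
  by (simp add: almost_period_def)

lemma almost_period_0 [simp]: "almost_period F 0"
  by (simp add: almost_period_def)

lemma drift_0 [simp]: "drift F 0 = 0"
  by (simp add: drift_def)

lemma almost_period_add:
  assumes "almost_period F a" "almost_period F b"
  shows "almost_period F (a + b)"
proof -
  have "MOST x. F (x + b + a) = F (x + b)"
    using assms(1) unfolding almost_period_def by (rule MOST_shift)
  then show ?thesis
    using assms(2) unfolding almost_period_def by eventually_elim (simp add: ac_simps)
qed

lemma almost_period_minus:
  assumes "almost_period F a"
  shows "almost_period F (- a)"
  using MOST_shift[OF assms[unfolded almost_period_def], of "- a"]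
  by (simp add: almost_period_def eq_commute)

lemma drift_add:
  assumes "almost_period F a" "almost_period F b"
  shows "drift F (a + b) = drift F a + drift F b"
proof -
  have "drift F (a + b) = Sum_any (\<lambda>x. (F (x + b + a) - F (x + b)) + (F (x + b) - F x))"
    by (simp add: drift_def ac_simps)
  also have "\<dots> = Sum_any (\<lambda>x. F (x + b + a) - F (x + b)) + drift F b"
    unfolding drift_def using assms[THEN almost_period_MOST_diff]
    by (intro Sum_any_add MOST_shift)
  also have "Sum_any (\<lambda>x. F (x + b + a) - F (x + b)) = drift F a"
    unfolding drift_def by (rule Sum_any_shift)
  finally show ?thesis .
qed

lemma drift_fun_add:
  assumes "almost_period F a" "almost_period G a"
  shows "drift (\<lambda>x. F x + G x) a = drift F a + drift G a"
proof -
  have "drift (\<lambda>x. F x + G x) a = Sum_any (\<lambda>x. (F (x + a) - F x) + (G (x + a) - G x))"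
    by (simp add: drift_def algebra_simps)
  also have "\<dots> = drift F a + drift G a"
    unfolding drift_def using assms[THEN almost_period_MOST_diff] by (rule Sum_any_add)
  finally show ?thesis .
qed

lemma drift_MOST_zero: "MOST x. F x = 0 \<Longrightarrow> drift F a = 0"
  unfolding drift_def
  by (subst Sum_any_diff) (simp_all add: MOST_shift[of "\<lambda>x. F x = 0"] Sum_any_shift)

lemma drift_cong_MOST:
  assumes "almost_period F a" "MOST x. G x = F x"
  shows "drift G a = drift F a"
proof -
  let ?h = "\<lambda>x. G x - F x"
  have h: "MOST x. ?h x = 0" using assms(2) by simp
  then have "MOST x. ?h (x + a) = 0" by (rule MOST_shift)
  with h have "almost_period ?h a"
    unfolding almost_period_def by eventually_elim simp
  from drift_fun_add[OF assms(1) this] show ?thesis by (simp add: drift_MOST_zero[OF h])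
qed

lemma drift_shift: "drift (\<lambda>x. F (x + b)) a = drift F a"
  using Sum_any_shift[of "\<lambda>x. F (x + a) - F x" b] by (simp add: drift_def ac_simps)

lemma drift_reflect: "drift (\<lambda>x. F (b - x)) a = - drift F a"
proof -
  have "drift (\<lambda>x. F (b - x)) a = Sum_any (\<lambda>x. - (F (b - a - x + a) - F (b - a - x)))"
    by (simp add: drift_def algebra_simps)
  also have "\<dots> = - drift F a"
    unfolding Sum_any_minus drift_def by (simp only: Sum_any_reflect[of "\<lambda>x. F (x + a) - F x"])
  finally show ?thesis .
qed

text \<open>Reflecting the sum at \<open>b'\<close> turns \<open>G - F\<close> into the difference of \<open>F\<close>, moved by \<open>b - b'\<close>,
  and \<open>G\<close>; the sum of both is a drift.\<close>
lemma Sum_any_diff_odd: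
  fixes F G :: "'a::ab_group_add \<Rightarrow> 'b::ring_1"
  assumes F: "\<And>x. F (b - x) = - F x" and G: "\<And>x. G (b' - x) = - G x"
    and almost: "MOST x. G x = F x"
  shows "2 * Sum_any (\<lambda>x. G x - F x) = drift F (b - b')"
proof -
  have reflected: "G (b' - x) - F (b' - x) = F (x + (b - b')) - G x" for x
    using F[of "b' - x"] F[of "x + (b - b')"] G[of x] by (simp add: algebra_simps)
  have "MOST x. G (b' - x) - F (b' - x) = 0"
    using MOST_reflect[OF almost, of b'] by simp
  then have "MOST x. F (x + (b - b')) - G x = 0" by (simp only: reflected)
  moreover have "Sum_any (\<lambda>x. G x - F x) = Sum_any (\<lambda>x. F (x + (b - b')) - G x)"
    using Sum_any_reflect[of "\<lambda>x. G x - F x" b'] by (simp add: reflected)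
  ultimately show ?thesis
    using Sum_any_add[of "\<lambda>x. F (x + (b - b')) - G x" "\<lambda>x. G x - F x"] almost
    by (simp add: drift_def mult_2)
qed

definition drift_on :: "'a set \<Rightarrow> ('a::ab_group_add \<Rightarrow> 'b::ring_1) \<Rightarrow> 'a \<Rightarrow> 'b" where
  "drift_on S F a = Sum_any (\<lambda>x. of_bool (x \<in> S) * (F (x + a) - F x))"

lemma drift_on_nonzeroE:
  assumes "drift_on S F a \<noteq> 0"
  obtains x where "x \<in> S" "F (x + a) \<noteq> F x"
proof -
  obtain x where "of_bool (x \<in> S) * (F (x + a) - F x) \<noteq> 0"
    using assms unfolding drift_on_def by (rule Sum_any.not_neutral_obtains_not_neutral)
  then show thesis using that[of x] by (cases "x \<in> S") auto
qed

lemma drift_on_eq_sum: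
  assumes "almost_period F a"
  shows "drift_on S F a = (\<Sum>x | x \<in> S \<and> F (x + a) \<noteq> F x. F (x + a) - F x)"
proof -
  have "finite {x. x \<in> S \<and> F (x + a) \<noteq> F x}"
    using assms unfolding almost_period_iff_finite by (rule rev_finite_subset) blast
  then have "drift_on S F a
    = (\<Sum>x | x \<in> S \<and> F (x + a) \<noteq> F x. of_bool (x \<in> S) * (F (x + a) - F x))"
    unfolding drift_on_def by (rule Sum_any.expand_superset) auto
  then show ?thesis by simp
qed

lemma drift_on_Un_disjoint:
  assumes "almost_period F a" "S \<inter> T = {}"
  shows "drift_on (S \<union> T) F a = drift_on S F a + drift_on T F a"
proof -
  have MOST_zero: "MOST x. of_bool (x \<in> A) * (F (x + a) - F x) = 0" for A
    using almost_period_MOST_diff[OF assms(1)] by eventually_elim simp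
  have "of_bool (x \<in> S \<union> T) * (F (x + a) - F x)
    = of_bool (x \<in> S) * (F (x + a) - F x) + of_bool (x \<in> T) * (F (x + a) - F x)" for x
    using assms(2) by auto
  then show ?thesis
    unfolding drift_on_def by (simp only: Sum_any_add[OF MOST_zero MOST_zero])
qed

lemma drift_on_singleton: "drift_on {x} F a = F (x + a) - F x"
proof -
  have "drift_on {x} F a = Sum_any (\<lambda>y. if y = x then F (y + a) - F y else 0)"
    unfolding drift_on_def by (rule Sum_any.cong) auto
  then show ?thesis by simp
qed

subsection \<open>Integer multiples\<close>

definition zmul :: "int \<Rightarrow> 'a::ab_group_add \<Rightarrow> 'a" where
  "zmul k a = (if 0 \<le> k then ((+) a ^^ nat k) 0 else - (((+) a ^^ nat (- k)) 0))"

lemma zmul_1 [simp]: "zmul 1 a = a"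
  by (simp add: zmul_def)

lemma zmul_add_1: "zmul (k + 1) a = zmul k a + a"
proof -
  consider (nonneg) "0 \<le> k" | (minus_one) "k = -1" | (below) "k < -1" by linarith
  then show ?thesis
  proof cases
    case nonneg
    then have "nat (k + 1) = Suc (nat k)" by simp
    with nonneg show ?thesis by (simp add: zmul_def add.commute)
  next
    case minus_one
    then show ?thesis by (simp add: zmul_def)
  next
    case below
    then have "nat (- k) = Suc (nat (- (k + 1)))" by simp
    with below show ?thesis by (simp add: zmul_def)
  qed
qed

interpretation zmul: additive "\<lambda>k. zmul k a" for a
proof
  show "zmul (m + n) a = zmul m a + zmul n a" for m n
  proof (induction n rule: int_induct[where k = 0])
    case base
    show ?case by (simp add: zmul_def)
  next
    case (step1 i)
    then show ?case using zmul_add_1[of "m + i" a] zmul_add_1[of i a] by (simp add: ac_simps)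
  next
    case (step2 i)
    then show ?case using zmul_add_1[of "m + (i - 1)" a] zmul_add_1[of "i - 1" a]
      by (simp add: algebra_simps)
  qed
qed

lemma almost_period_zmul:
  assumes "almost_period F a"
  shows "almost_period F (zmul n a)"
proof (induction n rule: int_induct[where k = 0])
  case base
  show ?case by (simp add: zmul.zero)
next
  case (step1 i)
  then show ?case using assms by (simp add: zmul.add almost_period_add)
next
  case (step2 i)
  then show ?case using almost_period_add[OF _ almost_period_minus[OF assms]]
    by (simp add: zmul.diff)
qed

lemma drift_zmul:
  fixes F :: "'a::ab_group_add \<Rightarrow> 'b::ring_1"
  assumes "almost_period F a"
  shows "drift F (zmul n a) = of_int n * drift F a"
proof (induction n rule: int_induct[where k = 0])
  case base
  show ?case by (simp add: zmul.zero)
next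
  case (step1 i)
  then show ?case using assms
    by (simp add: zmul.add drift_add almost_period_zmul distrib_right)
next
  case (step2 i)
  have "drift F (zmul (i - 1) a) + drift F a = drift F (zmul i a)"
    using drift_add[OF almost_period_zmul[OF assms, of "i - 1"] assms] by (simp add: zmul.diff)
  with step2 show ?case by (simp add: algebra_simps)
qed

lemma inj_zmul_if_drift_nonzero:
  fixes F :: "'a::ab_group_add \<Rightarrow> 'b::linordered_idom"
  assumes "almost_period F t" "drift F t \<noteq> 0"
  shows "inj (\<lambda>n. zmul n t)"
proof (rule injI)
  fix m n assume "zmul m t = zmul n t"
  then have "drift F (zmul (m - n) t) = 0" by (simp add: zmul.diff)
  then show "m = n" using assms by (simp add: drift_zmul)
qed

lemma drift_proportional_if_commensurable:
  fixes F G :: "'a::ab_group_add \<Rightarrow> 'b::linordered_idom"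
  assumes "almost_period F a" "almost_period G a" "almost_period F t" "almost_period G t"
    and "zmul m a = zmul n t" "m \<noteq> 0"
  shows "drift G t * drift F a = drift F t * drift G a"
proof -
  have "of_int m * drift F a = of_int n * drift F t" "of_int m * drift G a = of_int n * drift G t"
    using assms by (metis drift_zmul)+
  then have "of_int m * (drift G t * drift F a) = of_int m * (drift F t * drift G a)"
    by algebra
  with \<open>m \<noteq> 0\<close> show ?thesis by simp
qed

subsection \<open>Orbits and jumps\<close>

definition orbit :: "'a::ab_group_add \<Rightarrow> 'a \<Rightarrow> 'a set" where
  "orbit t x = range (\<lambda>n. x + zmul n t)"

lemma mem_orbit_iff: "y \<in> orbit t x \<longleftrightarrow> (\<exists>n. y - x = zmul n t)"
  by (auto simp: orbit_def image_iff algebra_simps)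

lemma orbit_refl [simp]: "x \<in> orbit t x"
  unfolding mem_orbit_iff by (metis diff_self zmul.zero)

lemma orbit_eq_iff: "orbit t y = orbit t x \<longleftrightarrow> y \<in> orbit t x"
proof
  assume "y \<in> orbit t x"
  then obtain n where n: "y = x + zmul n t" by (auto simp: orbit_def)
  have "z - y = zmul k t \<longleftrightarrow> z - x = zmul (k + n) t" for z k
    by (auto simp: n zmul.add algebra_simps)
  then show "orbit t y = orbit t x"
    unfolding set_eq_iff mem_orbit_iff by (metis diff_add_cancel)
qed (metis orbit_refl)

lemma add_mem_orbit_iff: "y + a \<in> orbit t (x + a) \<longleftrightarrow> y \<in> orbit t x"
  by (simp add: mem_orbit_iff)

lemma reflect_mem_orbit_iff: "b - y \<in> orbit t (b - x) \<longleftrightarrow> y \<in> orbit t x"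
proof -
  have "x - y = zmul n t \<longleftrightarrow> y - x = zmul (- n) t" for n
    by (auto simp: zmul.minus algebra_simps)
  then show ?thesis unfolding mem_orbit_iff by (simp, metis minus_minus)
qed

lemma orbit_period: "y + t \<in> orbit t x \<longleftrightarrow> y \<in> orbit t x"
proof -
  have "x + t \<in> orbit t x"
    unfolding mem_orbit_iff by (rule exI[of _ 1]) simp
  then show ?thesis using add_mem_orbit_iff[of y t t x] by (simp flip: orbit_eq_iff)
qed

definition jump :: "('a::ab_group_add \<Rightarrow> 'b::ring_1) \<Rightarrow> 'a \<Rightarrow> 'a \<Rightarrow> 'b" where
  "jump f t x = drift_on (orbit t x) f t"

lemma jump_eq_drift: "jump f t x = drift (\<lambda>y. of_bool (y \<in> orbit t x) * f y) t"
  by (simp add: jump_def drift_def drift_on_def orbit_period right_diff_distrib)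

lemma jump_cong_MOST:
  assumes "almost_period f t" "MOST x. g x = f x"
  shows "jump g t x = jump f t x"
  unfolding jump_eq_drift
proof (rule drift_cong_MOST)
  show "almost_period (\<lambda>y. of_bool (y \<in> orbit t x) * f y) t"
    using assms(1) unfolding almost_period_def by eventually_elim (simp add: orbit_period)
  show "MOST y. of_bool (y \<in> orbit t x) * g y = of_bool (y \<in> orbit t x) * f y"
    using assms(2) by eventually_elim simp
qed

lemma jump_cong_orbit: "y \<in> orbit t x \<Longrightarrow> jump f t y = jump f t x"
  by (simp add: jump_def flip: orbit_eq_iff)

lemma jump_shift:
  assumes "almost_period f t" "almost_period f a"
  shows "jump f t (x + a) = jump f t x"
proof -
  have "jump f t (x + a) = jump (\<lambda>y. f (y + a)) t x"
    using drift_shift[of "\<lambda>y. of_bool (y \<in> orbit t (x + a)) * f y" a t]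
    by (simp add: jump_eq_drift add_mem_orbit_iff)
  also have "\<dots> = jump f t x"
    using assms(1) assms(2)[unfolded almost_period_def] by (rule jump_cong_MOST)
  finally show ?thesis .
qed

lemma jump_reflect:
  assumes "almost_period f t" "MOST x. f (b - x) = f x"
  shows "jump f t (b - x) = - jump f t x"
proof -
  have "jump f t (b - x) = - jump (\<lambda>y. f (b - y)) t x"
    using drift_reflect[of "\<lambda>y. of_bool (y \<in> orbit t (b - x)) * f y" b t]
    by (simp add: jump_eq_drift reflect_mem_orbit_iff)
  also have "jump (\<lambda>y. f (b - y)) t x = jump f t x"
    using assms by (rule jump_cong_MOST)
  finally show ?thesis .
qed

text \<open>Translations by almost periods permute the finitely many orbits that carry a jump.\<close>
lemma almost_period_commensurable:
  assumes t: "almost_period f t" and a: "almost_period f a" and jump: "jump f t x \<noteq> 0"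
  obtains m n where "m > 0" "zmul m a = zmul n t"
proof -
  let ?D = "{y. f (y + t) \<noteq> f y}"
  have "finite ?D" using t by (simp add: almost_period_iff_finite)
  have "\<exists>y\<in>?D. y \<in> orbit t (x + zmul (int i) a)" for i
  proof -
    have "jump f t (x + zmul (int i) a) \<noteq> 0"
      using jump jump_shift[OF t almost_period_zmul[OF a]] by simp
    then show ?thesis unfolding jump_def by (rule drift_on_nonzeroE) blast
  qed
  then obtain g where g: "\<And>i. g i \<in> ?D" "\<And>i. g i \<in> orbit t (x + zmul (int i) a)" by metis
  have "finite (range g)" using g(1) by (intro finite_subset[OF _ \<open>finite ?D\<close>]) blast
  then have "\<not> inj g" using finite_imageD[of g UNIV] by auto
  then obtain i j where "i < j" "g i = g j"
    unfolding inj_def by (metis linorder_neqE_nat)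
  then have "x + zmul (int j) a \<in> orbit t (x + zmul (int i) a)"
    using g(2)[of i] g(2)[of j] by (metis orbit_eq_iff orbit_refl)
  then obtain n where "zmul (int j - int i) a = zmul n t"
    by (auto simp: mem_orbit_iff zmul.diff)
  with \<open>i < j\<close> show thesis using that[of "int j - int i" n] by simp
qed

text \<open>The drift of the jump-weighted function counts every orbit with the square of its jump.\<close>
lemma drift_jump_weighted_pos:
  fixes f :: "'a::ab_group_add \<Rightarrow> 'b::linordered_idom"
  assumes t: "almost_period f t" and jump: "jump f t x \<noteq> 0"
  shows "drift (\<lambda>x. jump f t x * f x) t > 0"
proof -
  let ?d = "\<lambda>y. f (y + t) - f y"
  let ?D = "{y. f (y + t) \<noteq> f y}"
  have D: "finite ?D" using t by (simp add: almost_period_iff_finite)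
  have orbit_sum: "(\<Sum>y\<in>{y\<in>?D. orbit t y = orbit t x}. jump f t y * ?d y) = jump f t x ^ 2" for x
  proof -
    have orbit: "{y\<in>?D. orbit t y = orbit t x} = {y. y \<in> orbit t x \<and> f (y + t) \<noteq> f y}"
      by (auto simp: orbit_eq_iff)
    have "(\<Sum>y\<in>{y\<in>?D. orbit t y = orbit t x}. jump f t y * ?d y)
      = (\<Sum>y | y \<in> orbit t x \<and> f (y + t) \<noteq> f y. jump f t x * ?d y)"
      unfolding orbit by (rule sum.cong) (auto simp: jump_cong_orbit)
    also have "\<dots> = jump f t x * jump f t x"
      unfolding jump_def drift_on_eq_sum[OF t, of "orbit t x"] by (simp only: sum_distrib_left)
    finally show ?thesis by (simp only: power2_eq_square)
  qed
  have "drift (\<lambda>x. jump f t x * f x) t = Sum_any (\<lambda>y. jump f t y * ?d y)"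
    using jump_shift[OF t t] by (simp add: drift_def right_diff_distrib)
  also have "\<dots> = (\<Sum>y\<in>?D. jump f t y * ?d y)"
    by (rule Sum_any.expand_superset[OF D]) auto
  also have "\<dots> = (\<Sum>C\<in>orbit t ` ?D. \<Sum>y\<in>{y\<in>?D. orbit t y = C}. jump f t y * ?d y)"
    by (rule sum.image_gen[OF D])
  also have "\<dots> > 0"
  proof -
    obtain y where y: "y \<in> orbit t x" "y \<in> ?D"
      using drift_on_nonzeroE[OF jump[unfolded jump_def]] by auto
    show ?thesis
    proof (rule sum_pos2[of _ "orbit t y"])
      show "(\<Sum>z\<in>{z\<in>?D. orbit t z = orbit t y}. jump f t z * ?d z) > 0"
        unfolding orbit_sum using jump jump_cong_orbit[OF y(1), of f] by simp
      show "(\<Sum>z\<in>{z\<in>?D. orbit t z = C}. jump f t z * ?d z) \<ge> 0" if "C \<in> orbit t ` ?D" for C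
        using that by (elim imageE) (simp only: orbit_sum zero_le_power2)
    qed (use D y(2) in auto)
  qed
  finally show ?thesis .
qed

definition ray :: "'a::ab_group_add \<Rightarrow> 'a \<Rightarrow> 'a set" where
  "ray t x = (\<lambda>n. x + zmul n t) ` {0..}"

lemma ray_step:
  assumes "inj (\<lambda>n. zmul n t)"
  shows "ray t x = insert x (ray t (x + t))" "x \<notin> ray t (x + t)"
proof -
  have step: "x + t + zmul n t = x + zmul (1 + n) t" for n
    by (simp add: zmul.add ac_simps)
  have nonneg: "{0::int..} = insert 0 ((+) 1 ` {0..})"
    unfolding image_add_atLeast by auto
  show "ray t x = insert x (ray t (x + t))"
    unfolding ray_def
    by (subst nonneg) (simp only: image_insert image_image step zmul.zero add_0_right)
  show "x \<notin> ray t (x + t)"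
  proof
    assume "x \<in> ray t (x + t)"
    then obtain n where "n \<ge> 0" "zmul (1 + n) t = zmul 0 t"
      by (auto simp: ray_def step zmul.zero)
    with injD[OF assms, of "1 + n" 0] show False by simp
  qed
qed

lemma drift_on_ray_step:
  assumes "almost_period f t" "inj (\<lambda>n. zmul n t)"
  shows "drift_on (ray t x) f t = (f (x + t) - f x) + drift_on (ray t (x + t)) f t"
  using drift_on_Un_disjoint[OF assms(1), of "{x}" "ray t (x + t)"] ray_step[OF assms(2), of x]
  by (simp add: drift_on_singleton)

lemma finite_orbit_hits_both_sides:
  assumes inj: "inj (\<lambda>n. zmul n t)" and D: "finite D"
  shows "finite {x. (\<exists>y\<in>D. y \<in> ray t x) \<and> (\<exists>z\<in>D. z \<in> orbit t x - ray t x)}"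
proof (rule finite_subset)
  define between where "between v = {n. n \<ge> 0 \<and> (\<exists>k<0. zmul (n - k) t = v)}" for v
  have "finite (between v)" for v
  proof (cases "between v = {}")
    case False
    then obtain m where "zmul m t = v" by (auto simp: between_def)
    then have "between v \<subseteq> {0..m}" using injD[OF inj] by (fastforce simp: between_def)
    then show ?thesis by (rule finite_subset) simp
  qed simp
  then show "finite (\<Union>(y, z)\<in>D \<times> D. (\<lambda>n. y - zmul n t) ` between (y - z))"
    using D by auto
  show "{x. (\<exists>y\<in>D. y \<in> ray t x) \<and> (\<exists>z\<in>D. z \<in> orbit t x - ray t x)}
    \<subseteq> (\<Union>(y, z)\<in>D \<times> D. (\<lambda>n. y - zmul n t) ` between (y - z))"
  proof clarify
    fix x y z assume y: "y \<in> D" "y \<in> ray t x" and z: "z \<in> D" "z \<in> orbit t x" "z \<notin> ray t x"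
    obtain n where n: "n \<ge> 0" "y = x + zmul n t" using y by (auto simp: ray_def)
    obtain k where k: "z = x + zmul k t" using z by (auto simp: orbit_def)
    with z have "k < 0" by (force simp: ray_def)
    with n k have "n \<in> between (y - z)" by (auto simp: between_def zmul.diff)
    moreover have "x = y - zmul n t" using n by simp
    ultimately show "x \<in> (\<Union>(y, z)\<in>D \<times> D. (\<lambda>n. y - zmul n t) ` between (y - z))"
      using y z by blast
  qed
qed

lemma MOST_drift_on_ray_zero:
  assumes t: "almost_period f t" "inj (\<lambda>n. zmul n t)" and zero: "\<And>x. jump f t x = 0"
  shows "MOST x. drift_on (ray t x) f t = 0"
proof -
  let ?D = "{y. f (y + t) \<noteq> f y}"
  have both_sides: "(\<exists>y\<in>?D. y \<in> ray t x) \<and> (\<exists>z\<in>?D. z \<in> orbit t x - ray t x)"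
    if ray_nonzero: "drift_on (ray t x) f t \<noteq> 0" for x
  proof
    show "\<exists>y\<in>?D. y \<in> ray t x" using ray_nonzero by (rule drift_on_nonzeroE) blast
    have "orbit t x = ray t x \<union> (orbit t x - ray t x)" by (auto simp: ray_def orbit_def)
    then have "drift_on (ray t x) f t + drift_on (orbit t x - ray t x) f t = 0"
      using drift_on_Un_disjoint[OF t(1), of "ray t x" "orbit t x - ray t x"] zero[of x]
      by (simp add: jump_def)
    then have "drift_on (orbit t x - ray t x) f t \<noteq> 0" using ray_nonzero by auto
    then show "\<exists>z\<in>?D. z \<in> orbit t x - ray t x" by (rule drift_on_nonzeroE) blast
  qed
  have "finite ?D" using t(1) by (simp add: almost_period_iff_finite)
  note finite_both_sides = finite_orbit_hits_both_sides[OF t(2) this]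
  show ?thesis
    unfolding eventually_cofinite
    by (rule finite_subset[OF Collect_mono finite_both_sides]) (intro impI both_sides)
qed

text \<open>On every orbit, \<open>e\<close> is the limit of \<open>f\<close> in the direction of \<open>t\<close>.\<close>
lemma jump_zero_imp_almost_invariant:
  assumes "almost_period f t" "inj (\<lambda>n. zmul n t)" "\<And>x. jump f t x = 0"
  obtains e where "\<And>x. e (x + t) = e x" "MOST x. e x = f x"
proof
  show "f (x + t) + drift_on (ray t (x + t)) f t = f x + drift_on (ray t x) f t" for x
    using drift_on_ray_step[OF assms(1,2), of x] by simp
  show "MOST x. f x + drift_on (ray t x) f t = f x"
    using MOST_drift_on_ray_zero[OF assms] by eventually_elim simp
qed

subsection \<open>Chirality\<close>

definition chirality :: "'a::ab_group_add \<Rightarrow> 'a \<Rightarrow> ('a \<Rightarrow> 'b::ring) \<Rightarrow> 'a \<Rightarrow> 'b" where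
  "chirality u v f x = f x * f (x + u) * f (x + v) - f x * f (x - u) * f (x - v)"

lemma chirality_shift: "chirality u v (\<lambda>x. f (x + a)) x = chirality u v f (x + a)"
  by (simp add: chirality_def algebra_simps)

lemma chirality_reflect: "chirality u v (\<lambda>x. f (b - x)) x = - chirality u v f (b - x)"
  by (simp add: chirality_def algebra_simps)

lemma chirality_cong_MOST:
  assumes "MOST x. g x = f x"
  shows "MOST x. chirality u v g x = chirality u v f x"
  using assms MOST_shift[OF assms, of u] MOST_shift[OF assms, of v]
    MOST_shift[OF assms, of "- u"] MOST_shift[OF assms, of "- v"]
  by eventually_elim (simp add: chirality_def)

lemma almost_period_chirality:
  assumes "almost_period f a"
  shows "almost_period (chirality u v f) a"
  using chirality_cong_MOST[OF assms[unfolded almost_period_def], of u v]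
  by (simp add: almost_period_def chirality_shift)

lemma jump_nonzero_if_chirality_drift:
  fixes f :: "'a::ab_group_add \<Rightarrow> 'b::linordered_idom"
  assumes t: "almost_period f t" and drift: "drift (chirality u v f) t \<noteq> 0"
  obtains x where "jump f t x \<noteq> 0"
proof (rule ccontr)
  note period = almost_period_chirality[OF t, of u v]
  assume "\<not> thesis"
  then have zero: "\<And>x. jump f t x = 0" using that by blast
  obtain e where e: "\<And>x. e (x + t) = e x" "MOST x. e x = f x"
    using jump_zero_imp_almost_invariant[OF t inj_zmul_if_drift_nonzero[OF period drift] zero]
    by blast
  have "drift (chirality u v f) t = drift (chirality u v e) t"
    using drift_cong_MOST[OF period chirality_cong_MOST[OF e(2)]] by simp
  also have "\<dots> = 0"
    by (simp add: drift_def e(1) flip: chirality_shift)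
  finally show False using drift by contradiction
qed

lemma chirality_drift_proportional_linear:
  fixes f :: "'a::ab_group_add \<Rightarrow> 'b::linordered_idom"
  obtains \<alpha> \<beta> :: 'b and \<omega> :: "'a \<Rightarrow> 'b" where "\<alpha> \<noteq> 0"
    "\<forall>a. almost_period f a \<longrightarrow> \<alpha> * drift (chirality u v f) a = \<beta> * drift (\<lambda>x. \<omega> x * f x) a"
    "\<forall>b x. (MOST y. f (b - y) = f y) \<longrightarrow> \<omega> (b - x) = - \<omega> x"
proof (cases "\<forall>a. almost_period f a \<longrightarrow> drift (chirality u v f) a = 0")
  case True
  then show thesis using that[of 1 0 "\<lambda>_. 0"] by simp
next
  case False
  then obtain t where t: "almost_period f t" and nonzero: "drift (chirality u v f) t \<noteq> 0" by blast
  obtain x where x: "jump f t x \<noteq> 0" using jump_nonzero_if_chirality_drift[OF t nonzero] .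
  let ?weighted = "\<lambda>x. jump f t x * f x"
  have weighted_period: "almost_period ?weighted a" if a: "almost_period f a" for a
    using a unfolding almost_period_def by eventually_elim (simp add: jump_shift[OF t a])
  show thesis
  proof (rule that)
    show "drift ?weighted t \<noteq> 0" using drift_jump_weighted_pos[OF t x] by simp
    show "\<forall>a. almost_period f a \<longrightarrow>
      drift ?weighted t * drift (chirality u v f) a = drift (chirality u v f) t * drift ?weighted a"
    proof (intro allI impI)
      fix a assume a: "almost_period f a"
      obtain m n where "m > 0" "zmul m a = zmul n t"
        using almost_period_commensurable[OF t a x] .
      with t a show "drift ?weighted t * drift (chirality u v f) a
        = drift (chirality u v f) t * drift ?weighted a"
        by (intro drift_proportional_if_commensurable almost_period_chirality weighted_period) auto
    qed
    show "\<forall>b x. (MOST y. f (b - y) = f y) \<longrightarrow> jump f t (b - x) = - jump f t x"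
      using jump_reflect[OF t] by blast
  qed
qed

subsection \<open>Recoloring a scalene triangle\<close>

definition scalene :: "'a::ab_group_add \<Rightarrow> 'a \<Rightarrow> 'a \<Rightarrow> bool" where
  "scalene p q r \<longleftrightarrow> (\<forall>b. (\<lambda>x. b - x) ` {p, q, r} \<noteq> {p, q, r})"

lemma scalene_distinct:
  assumes "scalene p q r"
  shows "p \<noteq> q" "p \<noteq> r" "q \<noteq> r"
proof -
  show "p \<noteq> q" using assms[unfolded scalene_def, rule_format, of "p + r"] by auto
  show "p \<noteq> r" using assms[unfolded scalene_def, rule_format, of "p + q"] by auto
  show "q \<noteq> r" using assms[unfolded scalene_def, rule_format, of "p + r"] by auto
qed

definition recolor :: "('a \<Rightarrow> 'b) \<Rightarrow> 'a \<Rightarrow> 'a \<Rightarrow> 'a \<Rightarrow> bool \<Rightarrow> bool \<Rightarrow> bool \<Rightarrow> 'a \<Rightarrow> 'b::zero_neq_one"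
  where "recolor f p q r i j k = f(p := of_bool i, q := of_bool j, r := of_bool k)"

lemma MOST_recolor: "MOST x. recolor f p q r i j k x = f x"
proof -
  have "MOST x. x \<noteq> p \<and> x \<noteq> q \<and> x \<noteq> r" by (simp add: MOST_conj_distrib)
  then show ?thesis by eventually_elim (simp add: recolor_def)
qed

lemma recolor_indep:
  shows "x \<noteq> p \<Longrightarrow> recolor f p q r i j k x = recolor f p q r i' j k x"
    and "x \<noteq> q \<Longrightarrow> recolor f p q r i j k x = recolor f p q r i j' k x"
    and "x \<noteq> r \<Longrightarrow> recolor f p q r i j k x = recolor f p q r i j k' x"
  by (simp_all add: recolor_def)

definition third_difference :: "(bool \<Rightarrow> bool \<Rightarrow> bool \<Rightarrow> 'a::ab_group_add) \<Rightarrow> 'a" where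
  "third_difference g = g True True True - g True True False - g True False True
     - g False True True + g True False False + g False True False + g False False True
     - g False False False"

lemma third_difference_eq_0:
  shows "(\<And>i j k. g i j k = g False j k) \<Longrightarrow> third_difference g = 0"
    and "(\<And>i j k. g i j k = g i False k) \<Longrightarrow> third_difference g = 0"
    and "(\<And>i j k. g i j k = g i j False) \<Longrightarrow> third_difference g = 0"
proof -
  show "third_difference g = 0" if "\<And>i j k. g i j k = g False j k"
    unfolding third_difference_def that[of True] by simp
  show "third_difference g = 0" if "\<And>i j k. g i j k = g i False k"
    unfolding third_difference_def that[of _ True] by simp
  show "third_difference g = 0" if "\<And>i j k. g i j k = g i j False"
    unfolding third_difference_def that[of _ _ True] by simp
qed

lemma third_difference_diff:
  "third_difference (\<lambda>i j k. g i j k - h i j k) = third_difference g - third_difference h"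
  by (simp add: third_difference_def)

lemma third_difference_cmult:
  "third_difference (\<lambda>i j k. a * g i j k) = a * third_difference g"
  for a :: "'a::ring"
  by (simp add: third_difference_def algebra_simps)

lemma third_difference_Sum_any:
  assumes "\<And>i j k. MOST x. g i j k x = h x"
  shows "third_difference (\<lambda>i j k. Sum_any (\<lambda>x. g i j k x - h x))
    = Sum_any (\<lambda>x. third_difference (\<lambda>i j k. g i j k x))"
proof -
  let ?d = "\<lambda>i j k x. g i j k x - h x"
  have d: "MOST x. ?d i j k x = 0" for i j k using assms by simp
  have MOST_zero: "(MOST x. F x + G x = 0)" "(MOST x. F x - G x = 0)"
    if "MOST x. F x = 0" "MOST x. G x = 0" for F G :: "'a \<Rightarrow> 'b"
    using that by (eventually_elim, simp)+
  have "third_difference (\<lambda>i j k. Sum_any (?d i j k))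
    = Sum_any (\<lambda>x. third_difference (\<lambda>i j k. ?d i j k x))"
    unfolding third_difference_def by (simp only: Sum_any_add Sum_any_diff MOST_zero d)
  then show ?thesis by (simp add: third_difference_def)
qed

lemma third_difference_recolor:
  assumes "p \<noteq> q"
  shows "third_difference (\<lambda>i j k. recolor f p q r i j k x) = 0"
proof (cases "x = p")
  case True
  with assms show ?thesis by (intro third_difference_eq_0(2) recolor_indep(2)) simp
next
  case False
  then show ?thesis by (intro third_difference_eq_0(1) recolor_indep(1))
qed

text \<open>A product of three values depends on all three new colors only if it is taken over exactly
  the three recolored points.\<close>
lemma third_difference_recolor_product:
  fixes f :: "'a \<Rightarrow> 'b::comm_ring_1"
  assumes distinct: "p \<noteq> q" "p \<noteq> r" "q \<noteq> r"
  shows "third_difference (\<lambda>i j k. recolor f p q r i j k x * recolor f p q r i j k y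
    * recolor f p q r i j k z) = of_bool ({x, y, z} = {p, q, r})"
    (is "third_difference ?g = _")
proof (cases "{p, q, r} \<subseteq> {x, y, z}")
  case True
  then have permutation: "x = p \<and> y = q \<and> z = r \<or> x = p \<and> y = r \<and> z = q \<or> x = q \<and> y = p \<and> z = r
    \<or> x = q \<and> y = r \<and> z = p \<or> x = r \<and> y = p \<and> z = q \<or> x = r \<and> y = q \<and> z = p"
    using distinct by (simp, metis)
  then have "?g = (\<lambda>i j k. of_bool i * of_bool j * of_bool k)"
    using distinct by (elim disjE conjE) (simp_all add: recolor_def fun_eq_iff ac_simps)
  moreover have "{x, y, z} = {p, q, r}" using permutation by blast
  ultimately show ?thesis by (simp add: third_difference_def)
next
  case False
  then consider (p) "p \<notin> {x, y, z}" | (q) "q \<notin> {x, y, z}" | (r) "r \<notin> {x, y, z}" by blast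
  then have "third_difference ?g = 0"
  proof cases
    case p
    then show ?thesis
      by (intro third_difference_eq_0(1) arg_cong2[where f = "(*)"] recolor_indep(1)) auto
  next
    case q
    then show ?thesis
      by (intro third_difference_eq_0(2) arg_cong2[where f = "(*)"] recolor_indep(2)) auto
  next
    case r
    then show ?thesis
      by (intro third_difference_eq_0(3) arg_cong2[where f = "(*)"] recolor_indep(3)) auto
  qed
  moreover have "{x, y, z} \<noteq> {p, q, r}" using False by blast
  ultimately show ?thesis by simp
qed

text \<open>The mirror images do not fit on \<open>{p, q, r}\<close>, so only the first orientation contributes.\<close>
lemma third_difference_chirality_recolor:
  fixes f :: "'a::ab_group_add \<Rightarrow> 'b::comm_ring_1"
  assumes scalene: "scalene p q r"
  shows "third_difference (\<lambda>i j k. chirality (q - p) (r - p) (recolor f p q r i j k) x)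
    = of_bool ({x, x + (q - p), x + (r - p)} = {p, q, r})"
proof -
  have "{x, x - (q - p), x - (r - p)} = (\<lambda>y. x + p - y) ` {p, q, r}"
    by (auto simp: algebra_simps)
  then have "{x, x - (q - p), x - (r - p)} \<noteq> {p, q, r}"
    using scalene unfolding scalene_def by metis
  then show ?thesis
    by (simp add: chirality_def third_difference_diff
        third_difference_recolor_product[OF scalene_distinct[OF scalene]])
qed

lemma Sum_any_third_difference_chirality_pos:
  fixes f :: "'a::ab_group_add \<Rightarrow> 'b::linordered_idom"
  assumes "scalene p q r"
  shows "Sum_any (\<lambda>x. third_difference
    (\<lambda>i j k. chirality (q - p) (r - p) (recolor f p q r i j k) x)) > 0"
proof -
  let ?T = "\<lambda>x. of_bool ({x, x + (q - p), x + (r - p)} = {p, q, r}) :: 'b"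
  have "Sum_any ?T = (\<Sum>x\<in>{p, q, r}. ?T x)"
    by (rule Sum_any.expand_superset) auto
  also have "\<dots> > 0"
    by (rule sum_pos2[of _ p]) auto
  finally show ?thesis by (simp only: third_difference_chirality_recolor[OF assms])
qed

text \<open>By \<open>Sum_any_diff_odd\<close>, twice the two sums are the drifts of odd densities along \<open>b - b'\<close>.\<close>
lemma chirality_excess_linear:
  fixes f :: "'a::ab_group_add \<Rightarrow> 'b::linordered_idom"
  assumes f: "\<And>x. f (b - x) = f x"
  obtains \<alpha> \<beta> :: 'b and \<omega> :: "'a \<Rightarrow> 'b" where "\<alpha> \<noteq> 0"
    "\<forall>g b'. (\<forall>x. g (b' - x) = g x) \<longrightarrow> (MOST x. g x = f x) \<longrightarrow>
      \<alpha> * Sum_any (\<lambda>x. chirality u v g x - chirality u v f x)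
      = \<beta> * Sum_any (\<lambda>x. \<omega> x * g x - \<omega> x * f x)"
proof -
  let ?K = "chirality u v"
  obtain \<alpha> \<beta> \<omega> where "\<alpha> \<noteq> 0"
    and proportional: "\<forall>a. almost_period f a \<longrightarrow> \<alpha> * drift (?K f) a = \<beta> * drift (\<lambda>x. \<omega> x * f x) a"
    and \<omega>: "\<forall>b x. (MOST y. f (b - y) = f y) \<longrightarrow> \<omega> (b - x) = - \<omega> x"
    using chirality_drift_proportional_linear[of f u v] .
  have K_odd: "?K h (b - x) = - ?K h x" if "\<And>x. h (b - x) = h x" for h b x
    using chirality_reflect[of u v h b x] by (simp add: that)
  have "\<alpha> * Sum_any (\<lambda>x. ?K g x - ?K f x) = \<beta> * Sum_any (\<lambda>x. \<omega> x * g x - \<omega> x * f x)"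
    if g: "\<And>x. g (b' - x) = g x" and almost: "MOST x. g x = f x" for g b'
  proof -
    have almost_symmetric: "MOST x. f (b' - x) = f x"
      using almost MOST_reflect[OF almost, of b'] by eventually_elim (simp add: g)
    have "f (b' - x) = f (x + (b - b'))" for x
      using f[of "b' - x"] by (simp add: algebra_simps)
    with almost_symmetric have period: "almost_period f (b - b')"
      by (simp add: almost_period_def)
    have "2 * Sum_any (\<lambda>x. ?K g x - ?K f x) = drift (?K f) (b - b')"
      by (intro Sum_any_diff_odd K_odd f g chirality_cong_MOST almost)
    moreover have "2 * Sum_any (\<lambda>x. \<omega> x * g x - \<omega> x * f x) = drift (\<lambda>x. \<omega> x * f x) (b - b')"
    proof (rule Sum_any_diff_odd)
      show "MOST x. \<omega> x * g x = \<omega> x * f x" using almost by eventually_elim simp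
    qed (simp_all add: f g \<omega> almost_symmetric)
    ultimately have "2 * (\<alpha> * Sum_any (\<lambda>x. ?K g x - ?K f x))
      = 2 * (\<beta> * Sum_any (\<lambda>x. \<omega> x * g x - \<omega> x * f x))"
      using proportional period by (simp add: algebra_simps)
    then show ?thesis by simp
  qed
  then show thesis using that[OF \<open>\<alpha> \<noteq> 0\<close>] by blast
qed

lemma scalene_recoloring_without_reflection:
  fixes f :: "'a::ab_group_add \<Rightarrow> 'b::linordered_idom"
  assumes scalene: "scalene p q r"
  shows "\<exists>i j k. \<forall>b. \<exists>x. recolor f p q r i j k (b - x) \<noteq> recolor f p q r i j k x"
proof (rule ccontr)
  assume "\<not> ?thesis"
  then obtain B where B: "\<And>i j k x. recolor f p q r i j k (B i j k - x) = recolor f p q r i j k x"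
    by metis
  let ?F = "recolor f p q r"
  let ?base = "?F False False False"
  let ?K = "chirality (q - p) (r - p)"
  obtain \<alpha> \<beta> \<omega> where "\<alpha> \<noteq> 0"
    and proportional: "\<forall>g b'. (\<forall>x. g (b' - x) = g x) \<longrightarrow> (MOST x. g x = ?base x) \<longrightarrow>
      \<alpha> * Sum_any (\<lambda>x. ?K g x - ?K ?base x) = \<beta> * Sum_any (\<lambda>x. \<omega> x * g x - \<omega> x * ?base x)"
    using chirality_excess_linear[of ?base "B False False False" "q - p" "r - p", OF B] .
  have almost: "MOST x. ?F i j k x = ?base x" for i j k
    using MOST_recolor[of f p q r i j k] MOST_recolor[of f p q r False False False]
    by eventually_elim simp
  have "\<alpha> * Sum_any (\<lambda>x. third_difference (\<lambda>i j k. ?K (?F i j k) x))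
    = \<alpha> * third_difference (\<lambda>i j k. Sum_any (\<lambda>x. ?K (?F i j k) x - ?K ?base x))"
    by (simp only: third_difference_Sum_any[OF chirality_cong_MOST[OF almost]])
  also have "\<dots> = \<beta> * third_difference (\<lambda>i j k. Sum_any (\<lambda>x. \<omega> x * ?F i j k x - \<omega> x * ?base x))"
    by (simp only: proportional[rule_format, OF B almost] flip: third_difference_cmult)
  also have "\<dots> = \<beta> * Sum_any (\<lambda>x. third_difference (\<lambda>i j k. \<omega> x * ?F i j k x))"
  proof -
    have "MOST x. \<omega> x * ?F i j k x = \<omega> x * ?base x" for i j k
      using almost[of i j k] by eventually_elim simp
    then show ?thesis by (simp only: third_difference_Sum_any)
  qed
  also have "\<dots> = 0"
    using scalene_distinct(1)[OF scalene]
    by (simp add: third_difference_cmult third_difference_recolor)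
  finally show False
    using \<open>\<alpha> \<noteq> 0\<close> Sum_any_third_difference_chirality_pos[OF scalene, of f] by simp
qed

subsection \<open>Symmetric colorings\<close>

definition translation_symmetric :: "('a::ab_group_add \<Rightarrow> 'b) \<Rightarrow> bool" where
  "translation_symmetric c \<longleftrightarrow> (\<exists>a. a \<noteq> 0 \<and> (\<forall>x. c (x + a) = c x))"

definition reflection_symmetric :: "('a::ab_group_add \<Rightarrow> 'b) \<Rightarrow> bool" where
  "reflection_symmetric c \<longleftrightarrow> (\<exists>b. \<forall>x. c (b - x) = c x)"

lemma recoloring_not_translation_symmetric:
  fixes c :: "'a::ab_group_add \<Rightarrow> 'b"
  assumes "translation_symmetric c" "v \<noteq> c w"
  shows "\<not> translation_symmetric (c(w := v))"
proof
  let ?c = "c(w := v)"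
  assume "translation_symmetric ?c"
  then obtain a' where a': "a' \<noteq> 0" "\<And>x. ?c (x + a') = ?c x"
    unfolding translation_symmetric_def by blast
  obtain a where a: "a \<noteq> 0" "\<And>x. c (x + a) = c x"
    using assms(1) unfolding translation_symmetric_def by blast
  have moved_point: "c (w + a') = v" using a'(2)[of w] a'(1) by simp
  show False
  proof (cases "a + a' = 0")
    case True
    then have "w + a' + a = w" by (simp add: ac_simps)
    then show False using moved_point a(2) assms(2) by metis
  next
    case False
    have "c (w + a + a') = v" using moved_point a(2)[of "w + a'"] by (simp add: ac_simps)
    moreover have "c (w + a + a') = c (w + a)"
      using a'(2)[of "w + a"] a(1) False by (simp add: add.assoc)
    ultimately show False using a(2) assms(2) by simp
  qed
qed

lemma reflection_symmetric_if_recoloring: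
  fixes c :: "'a::ab_group_add \<Rightarrow> 'b"
  assumes "translation_symmetric c" "v \<noteq> c w" "reflection_symmetric (c(w := v))"
  shows "reflection_symmetric c"
proof -
  let ?c = "c(w := v)"
  obtain a where a: "a \<noteq> 0" "\<And>x. c (x + a) = c x"
    using assms(1) unfolding translation_symmetric_def by blast
  obtain b where b: "\<And>x. ?c (b - x) = ?c x"
    using assms(3) unfolding reflection_symmetric_def by blast
  have "b - w = w"
  proof (rule ccontr)
    assume "b - w \<noteq> w"
    then have "c (b - w + a) = v" using b[of w] a(2) by simp
    moreover have "c (w - a) = c w" using a(2)[of "w - a"] by simp
    moreover have "b - w + a \<noteq> w"
      using calculation assms(2) by metis
    ultimately show False
      using b[of "w - a"] a(1) assms(2) by (simp add: algebra_simps)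
  qed
  have "c (b - x) = c x" for x
  proof (cases "x = w")
    case False
    then have "b - x \<noteq> w" using \<open>b - w = w\<close> by (metis diff_diff_eq2 add_diff_cancel_left')
    with False show ?thesis using b[of x] by simp
  qed (simp add: \<open>b - w = w\<close>)
  then show ?thesis unfolding reflection_symmetric_def by blast
qed

lemma recoloring_asymmetric:
  fixes c :: "'a::ab_group_add \<Rightarrow> bool"
  assumes "\<not> reflection_symmetric c"
  obtains v where "\<not> translation_symmetric (c(w := v))" "\<not> reflection_symmetric (c(w := v))"
proof (cases "translation_symmetric c")
  case True
  then show thesis
    using that[of "\<not> c w"] recoloring_not_translation_symmetric[of c "\<not> c w" w]
      reflection_symmetric_if_recoloring[of c "\<not> c w" w] assms by blast
next
  case False
  then show thesis using that[of "c w"] assms by simp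
qed

lemma scalene_extension_asymmetric:
  fixes c :: "'a::ab_group_add \<Rightarrow> bool"
  assumes "scalene p q r"
  obtains c' where "\<And>x. x \<notin> {p, q, r} \<Longrightarrow> c' x = c x"
    "\<not> translation_symmetric c'" "\<not> reflection_symmetric c'"
proof -
  have recolor_of_bool: "recolor (\<lambda>x. of_bool (c x) :: int) p q r i j k
    = (\<lambda>x. of_bool ((c(p := i, q := j, r := k)) x))" for i j k
    by (auto simp: recolor_def)
  obtain i j k where "\<And>b. \<exists>x. (c(p := i, q := j, r := k)) (b - x) \<noteq> (c(p := i, q := j, r := k)) x"
    using scalene_recoloring_without_reflection[OF assms, of "\<lambda>x. of_bool (c x) :: int"]
    unfolding recolor_of_bool of_bool_eq_iff by blast
  then have "\<not> reflection_symmetric (c(p := i, q := j, r := k))"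
    unfolding reflection_symmetric_def by blast
  then obtain v where "\<not> translation_symmetric (c(p := i, q := j, r := k, p := v))"
    "\<not> reflection_symmetric (c(p := i, q := j, r := k, p := v))"
    by (rule recoloring_asymmetric)
  then show thesis by (intro that) auto
qed

subsection \<open>The group structure of the circle\<close>

lemma Rep_circle_bounds: "0 \<le> Rep_circle p" "Rep_circle p < 1"
  using Rep_circle[of p] by auto

lemma Rep_pt: "Rep_circle (pt x) = frac x"
  by (simp add: pt_def Abs_circle_inverse frac_lt_1)

lemma pt_Rep: "pt (Rep_circle p) = p"
  by (metis Rep_circle_bounds Rep_circle_inverse frac_eq pt_def)

lemma pt_eq_iff: "pt x = pt y \<longleftrightarrow> x - y \<in> \<int>"
proof -
  have "pt x = pt y \<longleftrightarrow> frac x = frac y" by (metis Rep_pt pt_Rep)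
  also have "\<dots> \<longleftrightarrow> x - frac y \<in> \<int>" by (simp add: frac_unique_iff frac_lt_1)
  also have "x - frac y = (x - y) + of_int \<lfloor>y\<rfloor>" by (simp add: frac_def)
  finally show ?thesis by (metis Ints_add Ints_diff Ints_of_int add_diff_cancel_right')
qed

instantiation circle :: ab_group_add
begin

definition "0 = pt 0"
definition "p + q = pt (Rep_circle p + Rep_circle q)"
definition "- p = pt (- Rep_circle p)"
definition "p - q = pt (Rep_circle p - Rep_circle q)" for p q :: circle

lemma pt_plus: "pt x + pt y = pt (x + y)"
  unfolding plus_circle_def Rep_pt by (simp add: pt_def)

lemma pt_uminus: "- pt x = pt (- x)"
  unfolding uminus_circle_def Rep_pt by (simp add: pt_def frac_neg_frac)

lemma pt_minus: "pt x - pt y = pt (x - y)"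
  unfolding minus_circle_def Rep_pt
  by (simp add: pt_def frac_diff_simp frac_add_simps(1)[of x "- y", simplified])

instance
proof
  fix p q r :: circle
  show "p + q + r = p + (q + r)"
    by (metis pt_Rep pt_plus add.assoc)
  show "p + q = q + p"
    by (simp add: plus_circle_def add.commute)
  show "0 + p = p"
    by (metis pt_Rep pt_plus zero_circle_def add_0)
  show "- p + p = 0"
    by (metis pt_Rep pt_plus pt_uminus zero_circle_def ab_left_minus)
  show "p - q = p + - q"
    by (metis pt_Rep pt_plus pt_uminus pt_minus diff_conv_add_uminus)
qed

end

lemma rot_eq: "rot a p = p + pt a"
  by (metis rot_def pt_Rep pt_plus)

lemma refl_eq: "refl a p = pt (2 * a) - p"
  by (metis refl_def pt_Rep pt_minus uminus_add_conv_diff)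

lemma O2_cases:
  assumes "\<gamma> \<in> O2"
  obtains (translation) a where "\<gamma> = (\<lambda>x. x + a)" | (reflection) b where "\<gamma> = (\<lambda>x. b - x)"
  using assms unfolding O2_def by (auto simp: fun_eq_iff rot_eq refl_eq)

lemma distinguishing_if_asymmetric:
  assumes "\<not> translation_symmetric c" "\<not> reflection_symmetric c"
  shows "distinguishing c"
  unfolding distinguishing_def
proof (intro ballI impI notI)
  fix \<gamma> assume "\<gamma> \<in> O2" "\<gamma> \<noteq> id" "c \<circ> \<gamma> = c"
  from \<open>\<gamma> \<in> O2\<close> show False
  proof (cases rule: O2_cases)
    case (translation a)
    with \<open>\<gamma> \<noteq> id\<close> \<open>c \<circ> \<gamma> = c\<close> have "translation_symmetric c"
      unfolding translation_symmetric_def by (intro exI[of _ a]) (auto simp: fun_eq_iff)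
    with assms(1) show False by contradiction
  next
    case (reflection b)
    with \<open>c \<circ> \<gamma> = c\<close> have "reflection_symmetric c"
      unfolding reflection_symmetric_def by (intro exI[of _ b]) (auto simp: fun_eq_iff)
    with assms(2) show False by contradiction
  qed
qed

lemma scalene_trivial_pointwise_stabilizer:
  assumes "{p, q, r} \<subseteq> W" "scalene p q r"
  shows "trivial_pointwise_stabilizer W"
  unfolding trivial_pointwise_stabilizer_def
proof (intro ballI impI)
  fix \<gamma> assume "\<gamma> \<in> O2" and "\<forall>w\<in>W. \<gamma> w = w"
  then have fixed: "\<gamma> p = p" "\<gamma> q = q" "\<gamma> r = r" using assms(1) by auto
  from \<open>\<gamma> \<in> O2\<close> show "\<gamma> = id"
  proof (cases rule: O2_cases)
    case (translation a)
    then show ?thesis using fixed(1) by (simp add: fun_eq_iff)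
  next
    case (reflection b)
    then have "(\<lambda>x. b - x) ` {p, q, r} = {p, q, r}" using fixed by simp
    then show ?thesis using assms(2) unfolding scalene_def by blast
  qed
qed

lemma propP_if_scalene:
  assumes "{p, q, r} \<subseteq> W" "scalene p q r"
  shows "propP W"
  unfolding propP_def
proof (intro conjI allI)
  show "trivial_pointwise_stabilizer W"
    using assms by (rule scalene_trivial_pointwise_stabilizer)
  show "\<exists>c'. (\<forall>x. x \<notin> W \<longrightarrow> c' x = c x) \<and> distinguishing c'" for c
    using scalene_extension_asymmetric[OF assms(2), of c] distinguishing_if_asymmetric assms(1)
    by (metis subsetD)
qed

subsection \<open>Five points without a scalene triangle\<close>

lemma not_scalene_cases:
  assumes "\<not> scalene p q r" "p \<noteq> q" "p \<noteq> r" "q \<noteq> r"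
  shows "p + p = q + r \<or> q + q = p + r \<or> r + r = p + q \<or> p + p = q + q \<and> q + q = r + r"
proof -
  obtain b where "b - p \<in> {p, q, r}" "b - q \<in> {p, q, r}" "b - r \<in> {p, q, r}"
    using assms(1) unfolding scalene_def by blast
  then show ?thesis using assms(2-) by (auto simp: diff_eq_eq add.commute)
qed

lemma Ints_eqI:
  fixes x :: "'a::linordered_idom"
  assumes "x \<in> \<int>" "of_int n - 1 < x" "x < of_int n + 1"
  shows "x = of_int n"
proof -
  obtain z where z: "x = of_int z" using assms(1) by (rule Ints_cases)
  then have "of_int (n - 1) < (of_int z :: 'a)" "of_int z < (of_int (n + 1) :: 'a)"
    using assms(2,3) by simp_all
  then show ?thesis unfolding of_int_less_iff by (simp add: z)
qed

text \<open>The third arc is \<open>1 - a - b\<close>.\<close>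
definition isosceles_arcs :: "real \<Rightarrow> real \<Rightarrow> bool" where
  "isosceles_arcs a b \<longleftrightarrow> a = b \<or> 2 * a + b = 1 \<or> a + 2 * b = 1"

lemma isosceles_arcs_commute: "isosceles_arcs a b \<longleftrightarrow> isosceles_arcs b a"
  by (auto simp: isosceles_arcs_def)

lemma isosceles_arcs_if_not_scalene:
  assumes less: "x < y" "y < z" "z < x + 1" and "\<not> scalene (pt x) (pt y) (pt z)"
  shows "isosceles_arcs (y - x) (z - y)"
proof -
  have ne: "pt x \<noteq> pt y" "pt x \<noteq> pt z" "pt y \<noteq> pt z"
    using less Ints_eqI[of "x - y" 0] Ints_eqI[of "x - z" 0] Ints_eqI[of "y - z" 0]
    by (auto simp: pt_eq_iff)
  from not_scalene_cases[OF assms(4) ne] consider (apex_x) "x + x - (y + z) \<in> \<int>"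
    | (apex_y) "y + y - (x + z) \<in> \<int>" | (apex_z) "z + z - (x + y) \<in> \<int>"
    | (doubles_equal) "x + x - (y + y) \<in> \<int>" "y + y - (z + z) \<in> \<int>"
    by (auto simp: pt_plus pt_eq_iff)
  then show ?thesis
  proof cases
    case apex_x
    then have "x + x - (y + z) = of_int (- 1)" by (rule Ints_eqI) (use less in auto)
    then show ?thesis by (simp add: isosceles_arcs_def)
  next
    case apex_y
    then have "y + y - (x + z) = of_int 0" by (rule Ints_eqI) (use less in auto)
    then show ?thesis by (simp add: isosceles_arcs_def)
  next
    case apex_z
    then have "z + z - (x + y) = of_int 1" by (rule Ints_eqI) (use less in auto)
    then show ?thesis by (simp add: isosceles_arcs_def)
  next
    case doubles_equal
    have "x + x - (y + y) = of_int (- 1)"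
      using doubles_equal(1) by (rule Ints_eqI) (use less in auto)
    moreover have "y + y - (z + z) = of_int (- 1)"
      using doubles_equal(2) by (rule Ints_eqI) (use less in auto)
    ultimately show ?thesis using less by simp
  qed
qed

lemma gap_neq_sum_other_three_gaps:
  assumes pos: "g0 > 0" "g1 > 0" "g2 > 0" "g3 > 0" "g4 > 0"
    and total: "g0 + g1 + g2 + g3 + g4 = 1"
    and isosceles: "isosceles_arcs g1 g2" "isosceles_arcs g2 g3" "isosceles_arcs g3 g4"
      "isosceles_arcs g4 g0" "isosceles_arcs g1 (g2 + g3)"
  shows "g0 \<noteq> g2 + g3 + g4"
proof
  assume long: "g0 = g2 + g3 + g4"
  have "g4 \<noteq> g1 + g2 + g3"
  proof
    assume "g4 = g1 + g2 + g3"
    then show False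
      using isosceles(3) pos total long unfolding isosceles_arcs_def by linarith
  qed
  then have "g4 = g1"
    using isosceles(4) pos total long unfolding isosceles_arcs_def by linarith
  moreover from this have "g1 = g2 + g3"
    using isosceles(5) pos total long unfolding isosceles_arcs_def by argo
  ultimately have "g1 = 1/5" "g2 + g3 = 1/5" using total long by linarith+
  moreover from this have "g2 = 1/10"
    using isosceles(2) pos unfolding isosceles_arcs_def by linarith
  ultimately show False
    using isosceles(1) unfolding isosceles_arcs_def by linarith
qed

lemma consecutive_gaps_equal:
  fixes x :: "nat \<Rightarrow> real"
  assumes mono: "strict_mono x" and wrap: "\<And>i. x (i + 5) = x i + 1"
    and isosceles: "\<And>i j k. i < j \<Longrightarrow> j < k \<Longrightarrow> k < i + 5 \<Longrightarrow> isosceles_arcs (x j - x i) (x k - x j)"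
  shows "x (i + 2) - x (i + 1) = x (i + 1) - x i"
proof -
  define g0 g1 g2 g3 g4 where g: "g0 = x (i + 1) - x i" "g1 = x (i + 2) - x (i + 1)"
    "g2 = x (i + 3) - x (i + 2)" "g3 = x (i + 4) - x (i + 3)" "g4 = x (i + 5) - x (i + 4)"
  have g0: "x (i + 6) - x (i + 5) = g0"
    using wrap[of i] wrap[of "i + 1"] by (simp add: g add.commute[of i])
  have pos: "g0 > 0" "g1 > 0" "g2 > 0" "g3 > 0" "g4 > 0"
    using strict_monoD[OF mono] by (simp_all add: g)
  have total: "g0 + g1 + g2 + g3 + g4 = 1" using wrap[of i] by (simp add: g)
  have adjacent: "isosceles_arcs g0 g1" "isosceles_arcs g1 g2" "isosceles_arcs g2 g3"
      "isosceles_arcs g3 g4" "isosceles_arcs g4 g0"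
    using isosceles[of i "i + 1" "i + 2"] isosceles[of "i + 1" "i + 2" "i + 3"]
      isosceles[of "i + 2" "i + 3" "i + 4"] isosceles[of "i + 3" "i + 4" "i + 5"]
      isosceles[of "i + 4" "i + 5" "i + 6"] g0 by (simp_all add: g)
  have merged: "isosceles_arcs g1 (g2 + g3)" "isosceles_arcs (g3 + g4) g0"
    using isosceles[of "i + 1" "i + 2" "i + 4"] isosceles[of "i + 3" "i + 5" "i + 6"] g0
    by (simp_all add: g)
  have "g0 \<noteq> g2 + g3 + g4"
    using pos total adjacent merged by (intro gap_neq_sum_other_three_gaps[of g0 g1]) auto
  moreover have "g1 \<noteq> g4 + g3 + g2"
    using pos total adjacent merged
    by (intro gap_neq_sum_other_three_gaps[of g1 g0]) (auto simp: isosceles_arcs_commute add_ac)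
  ultimately have "g1 = g0"
    using adjacent(1) total unfolding isosceles_arcs_def by linarith
  then show ?thesis by (simp add: g)
qed

definition cyclic_lift :: "real list \<Rightarrow> nat \<Rightarrow> real" where
  "cyclic_lift xs i = xs ! (i mod length xs) + real (i div length xs)"

lemma strict_mono_cyclic_lift:
  assumes sorted: "sorted_wrt (<) xs" and bounds: "set xs \<subseteq> {0..<1}" and "xs \<noteq> []"
  shows "strict_mono (cyclic_lift xs)"
  unfolding strict_mono_Suc_iff
proof
  fix i
  let ?n = "length xs"
  have "xs ! (j mod ?n) \<in> {0..<1}" for j
    using \<open>xs \<noteq> []\<close> by (intro subsetD[OF bounds] nth_mem) simp
  note nth_bounds = this[of i] this[of "Suc i"]
  show "cyclic_lift xs i < cyclic_lift xs (Suc i)"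
  proof (cases "Suc (i mod ?n) = ?n")
    case True
    then have "cyclic_lift xs (Suc i) = xs ! (Suc i mod ?n) + (real (i div ?n) + 1)"
      by (simp add: cyclic_lift_def div_Suc mod_Suc)
    then show ?thesis using nth_bounds by (simp add: cyclic_lift_def)
  next
    case False
    then have "Suc (i mod ?n) < ?n"
      using Suc_leI[OF mod_less_divisor[of ?n i]] \<open>xs \<noteq> []\<close> by simp
    then have "xs ! (i mod ?n) < xs ! Suc (i mod ?n)"
      by (intro sorted_wrt_nth_less[OF sorted]) auto
    with False show ?thesis by (simp add: cyclic_lift_def div_Suc mod_Suc)
  qed
qed

lemma finite_circle_set_lift:
  fixes W :: "circle set"
  assumes "finite W" "W \<noteq> {}"
  obtains x :: "nat \<Rightarrow> real" where "strict_mono x" "\<And>i. x (i + card W) = x i + 1"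
    "W = (pt \<circ> x) ` {..<card W}" "\<And>i. pt (x i) \<in> W"
proof
  define xs where "xs = sorted_list_of_set (Rep_circle ` W)"
  have set_xs: "set xs = Rep_circle ` W" using assms by (simp add: xs_def)
  have length_xs: "length xs = card W"
    by (simp add: xs_def card_image inj_on_def Rep_circle_inject)
  have "card W > 0" using assms by (simp add: card_gt_0_iff)
  show "strict_mono (cyclic_lift xs)"
  proof (rule strict_mono_cyclic_lift)
    show "sorted_wrt (<) xs" unfolding xs_def by (rule strict_sorted_list_of_set)
    show "set xs \<subseteq> {0..<1}" using Rep_circle_bounds by (auto simp: set_xs)
    show "xs \<noteq> []" using \<open>card W > 0\<close> length_xs by auto
  qed
  show "cyclic_lift xs (i + card W) = cyclic_lift xs i + 1" for i
    using \<open>card W > 0\<close> by (simp add: cyclic_lift_def length_xs)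
  have "W = pt ` Rep_circle ` W" by (simp add: image_image pt_Rep)
  also have "Rep_circle ` W = cyclic_lift xs ` {..<card W}"
    by (auto simp: cyclic_lift_def image_iff set_xs[symmetric] in_set_conv_nth length_xs)
  finally show W: "W = (pt \<circ> cyclic_lift xs) ` {..<card W}" by (simp add: image_comp)
  show "pt (cyclic_lift xs i) \<in> W" for i
  proof -
    have "pt (cyclic_lift xs i) = pt (cyclic_lift xs (i mod card W))"
      by (simp add: cyclic_lift_def length_xs pt_eq_iff)
    then show ?thesis using \<open>card W > 0\<close> by (subst W) simp
  qed
qed

lemma pentagon_if_no_scalene:
  assumes card: "card W = 5"
    and no_scalene: "\<And>p q r. {p, q, r} \<subseteq> W \<Longrightarrow> \<not> scalene p q r"
  shows "O2_congruent W pentagon"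
proof -
  have "finite W" "W \<noteq> {}" using card by (auto intro: card_ge_0_finite)
  then obtain x :: "nat \<Rightarrow> real" where mono: "strict_mono x" and wrap: "\<And>i. x (i + 5) = x i + 1"
    and W: "W = (pt \<circ> x) ` {..<5}" "\<And>i. pt (x i) \<in> W"
    by (rule finite_circle_set_lift) (simp add: card)
  have isosceles: "isosceles_arcs (x j - x i) (x k - x j)" if "i < j" "j < k" "k < i + 5" for i j k
    using strict_monoD[OF mono] that wrap[of i] W(2) no_scalene
    by (intro isosceles_arcs_if_not_scalene) fastforce+
  define d where "d = x 1 - x 0"
  have gap: "x (Suc i) - x i = d" for i
  proof (induction i)
    case (Suc i)
    then show ?case using consecutive_gaps_equal[OF mono wrap isosceles, of i] by simp
  qed (simp add: d_def)
  have x: "x i - x 0 = real i * d" for i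
  proof (induction i)
    case (Suc i)
    then show ?case using gap[of i] by (simp add: algebra_simps)
  qed simp
  have "d = 1/5" using x[of 5] wrap[of 0] by simp
  then have "x i - x 0 = real i / 5" for i by (simp add: x)
  then have "rot (- x 0) (pt (x i)) = pt (real i / 5)" for i
    by (metis rot_eq pt_plus diff_conv_add_uminus)
  then have "rot (- x 0) ` W = (\<lambda>i. pt (real i / 5)) ` {..<5}"
    by (simp add: W(1) image_image)
  also have "\<dots> = pentagon"
    by (simp add: pentagon_def lessThan_nat_numeral lessThan_Suc insert_commute)
  finally show ?thesis by (auto simp: O2_congruent_def O2_def)
qed

theorem theorem2p4p4:
  fixes W :: "circle set"
  assumes "card W = 5"
    and "\<not> O2_congruent W pentagon"
  shows "propP W"
proof -
  obtain p q r where "{p, q, r} \<subseteq> W" "scalene p q r"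
    using pentagon_if_no_scalene assms by blast
  then show ?thesis by (rule propP_if_scalene)
qed

end
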